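(* Let $k\ge 1$. For each LL($k$) linear conjunctive grammar $G=(\Sigma,N,R,S)$ there exists an aligned LL(1) linear conjunctive grammar $G'$ that defines the same language, i.e. $L(G')=L(G)$.
   Context: A linear conjunctive grammar is a quadruple $G=(\Sigma,N,R,S)$, where $\Sigma$ is a finite alphabet, $N$ is a finite set of nonterminals (disjoint from $\Sigma$), $S\in N$ is the initial nonterminal, and $R$ is a finite set of rules, each either of the form $A\to u_1B_1v_1\,\&\cdots\&\,u_rB_rv_r$ with $r\ge 1$, $A,B_i\in N$, $u_i,v_i\in\Sigma^*$ (each $u_iB_iv_i$ is called a conjunct), or of the form $A\to y$ with $A\in N$, $y\in\Sigma^*$. Parse trees (finite, defined inductively). A parse tree of a string $w\in\Sigma^*$ as $A\in N$ has a root labelled $A$ and the symbols of $w$ as its ordered leaves, and either a rule $A\to w\in R$ is applied at the root (whose immediate descendants are all the leaves), or a rule $A\to u_1B_1v_1\,\&\cdots\&\,u_rB_rv_r\in R$ is applied at the root, where for each $i$ one has $w=u_iy_iv_i$ for some $y_i$, and the root has, for each $i$, a separate group of descendants: the first $|u_i|$ leaves, a node $B_i$ which is the root of a parse tree of $y_i$ as $B_i$, and the last $|v_i|$ leaves (all conjuncts share the same leaves). $L_G(A)$ is the set of strings having a parse tree as $A$, and $L(G)=L_G(S)$. A parse tree with no nonterminal mentioned is a parse tree as $S$. Position of subtrees. In a parse tree of $w$ (as $S$), every node labelled with a nonterminal is the root of a subtree occupying a definite segment of $w$: the root occupies $w$; if a node occupies $y$ in $w=pyq$ and applies a rule $A\to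 u_1B_1v_1\,\&\cdots\&\,u_rB_rv_r$ with $y=u_iy_iv_i$, then its child $B_i$ occupies $y_i$ in $w=(pu_i)\,y_i\,(v_iq)$. A subtree whose root is labelled $A$ is called an $A$-subtree; if it occupies $y$ in $w=pyq$, it defines the string $y$. LL($k$) grammars. An LL($k$) table for $G$ is a partial function $T\colon N\times\Sigma^{\le k}\to R$ such that for every subtree $\tau$ of any parse tree (as $S$), if $A$ is the label of the root of $\tau$, $\tau$ occupies $y$ in $w=pyq$, and $x\in\Sigma^{\le k}$ consists of the first $k$ symbols of $yq$ (or is all of $yq$ if $|yq|<k$), then the rule applied at the root of $\tau$ is $T(A,x)$. $G$ is LL($k$) if an LL($k$) table for it exists. Aligned grammars. A linear conjunctive grammar is aligned if each of its rules is either of the form $A\to aC_1v_1\,\&\cdots\&\,aC_mv_m$ with $a\in\Sigma$ (the same $a$ in all conjuncts), $m\ge 1$, $C_1,\dots,C_m\in N$, $v_1,\dots,v_m\in\Sigma^*$, or of the form $A\to y$ with $y\in\Sigma^*$. *)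

theory Defs
  imports Main
begin

text \<open>Terminals and nonterminals have separate types, so the alphabet and the set of nonterminals
  are disjoint by typing. A conjunct \<open>u B v\<close> is the triple \<open>(u, B, v)\<close>.\<close>

type_synonym ('a, 'n) conjunct = "'a list \<times> 'n \<times> 'a list"

datatype ('a, 'n) rule =
    Conj_Rule 'n "('a, 'n) conjunct list"
  | String_Rule 'n "'a list"

fun lhs :: "('a, 'n) rule \<Rightarrow> 'n" where
  "lhs (Conj_Rule A cs) = A"
| "lhs (String_Rule A y) = A"

record ('a, 'n) grammar =
  terminals :: "'a set"
  nonterminals :: "'n set"
  rules :: "('a, 'n) rule set"
  start :: 'n

fun wf_rule :: "'a set \<Rightarrow> 'n set \<Rightarrow> ('a, 'n) rule \<Rightarrow> bool" where
  "wf_rule \<Sigma> N (Conj_Rule A cs) \<longleftrightarrow>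
     A \<in> N \<and> cs \<noteq> [] \<and> (\<forall>(u, B, v) \<in> set cs. u \<in> lists \<Sigma> \<and> B \<in> N \<and> v \<in> lists \<Sigma>)"
| "wf_rule \<Sigma> N (String_Rule A y) \<longleftrightarrow> A \<in> N \<and> y \<in> lists \<Sigma>"

definition linear_conjunctive_grammar :: "('a, 'n) grammar \<Rightarrow> bool" where
  "linear_conjunctive_grammar G \<longleftrightarrow>
     finite (terminals G) \<and> finite (nonterminals G) \<and> finite (rules G) \<and>
     start G \<in> nonterminals G \<and>
     (\<forall>r \<in> rules G. wf_rule (terminals G) (nonterminals G) r)"

text \<open>A node stores the rule applied at it and one subtree per conjunct, in order. The leaves are
  shared between the conjuncts and are not stored: they are the symbols of the string \<open>w\<close> in
  \<open>parse_tree G A w t\<close>. The label of a node is the left-hand side of its rule.\<close>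

datatype ('a, 'n) ptree = Node (root_rule: "('a, 'n) rule") (children: "('a, 'n) ptree list")

definition label :: "('a, 'n) ptree \<Rightarrow> 'n" where
  "label t = lhs (root_rule t)"

inductive parse_tree :: "('a, 'n) grammar \<Rightarrow> 'n \<Rightarrow> 'a list \<Rightarrow> ('a, 'n) ptree \<Rightarrow> bool"
  for G :: "('a, 'n) grammar" where
  string_rule: "String_Rule A w \<in> rules G \<Longrightarrow> parse_tree G A w (Node (String_Rule A w) [])"
| conj_rule: "Conj_Rule A cs \<in> rules G \<Longrightarrow>
    length ts = length cs \<Longrightarrow>
    (\<forall>i < length cs. \<forall>u B v. cs ! i = (u, B, v) \<longrightarrow>
       (\<exists>y. w = u @ y @ v \<and> parse_tree G B y (ts ! i))) \<Longrightarrow>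
    parse_tree G A w (Node (Conj_Rule A cs) ts)"

definition language_of :: "('a, 'n) grammar \<Rightarrow> 'n \<Rightarrow> 'a list set" where
  "language_of G A = {w. \<exists>t. parse_tree G A w t}"

definition language :: "('a, 'n) grammar \<Rightarrow> 'a list set" where
  "language G = language_of G (start G)"

text \<open>\<open>occupies t w \<tau> p y q\<close>: in the tree \<open>t\<close> of the string \<open>w\<close>, a node with subtree \<open>\<tau>\<close>
  occupies \<open>y\<close> in \<open>w = p y q\<close>.\<close>

inductive occupies ::
  "('a, 'n) ptree \<Rightarrow> 'a list \<Rightarrow> ('a, 'n) ptree \<Rightarrow> 'a list \<Rightarrow> 'a list \<Rightarrow> 'a list \<Rightarrow> bool"
  for t :: "('a, 'n) ptree" and w :: "'a list" where
  root: "occupies t w t [] w []"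
| child: "occupies t w (Node (Conj_Rule A cs) ts) p y q \<Longrightarrow>
    i < length cs \<Longrightarrow> i < length ts \<Longrightarrow> cs ! i = (u, B, v) \<Longrightarrow> y = u @ y' @ v \<Longrightarrow>
    occupies t w (ts ! i) (p @ u) y' (v @ q)"

definition LL_table ::
  "nat \<Rightarrow> ('a, 'n) grammar \<Rightarrow> ('n \<times> 'a list \<rightharpoonup> ('a, 'n) rule) \<Rightarrow> bool" where
  "LL_table k G T \<longleftrightarrow>
     dom T \<subseteq> nonterminals G \<times> {x \<in> lists (terminals G). length x \<le> k} \<and>
     ran T \<subseteq> rules G \<and>
     (\<forall>w t \<tau> p y q. parse_tree G (start G) w t \<longrightarrow> occupies t w \<tau> p y q \<longrightarrow>
        T (label \<tau>, take k (y @ q)) = Some (root_rule \<tau>))"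

definition LL :: "nat \<Rightarrow> ('a, 'n) grammar \<Rightarrow> bool" where
  "LL k G \<longleftrightarrow> (\<exists>T. LL_table k G T)"

fun aligned_rule :: "'a set \<Rightarrow> ('a, 'n) rule \<Rightarrow> bool" where
  "aligned_rule \<Sigma> (Conj_Rule A cs) \<longleftrightarrow> (\<exists>a \<in> \<Sigma>. \<forall>(u, C, v) \<in> set cs. u = [a])"
| "aligned_rule \<Sigma> (String_Rule A y) \<longleftrightarrow> True"

text \<open>The remaining conditions on the shape of the rules are part of
  \<open>linear_conjunctive_grammar\<close>.\<close>

definition aligned :: "('a, 'n) grammar \<Rightarrow> bool" where
  "aligned G \<longleftrightarrow> linear_conjunctive_grammar G \<and> (\<forall>r \<in> rules G. aligned_rule (terminals G) r)"

end

theory Submission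
  imports Defs
begin

text \<open>The new grammar reads \<open>k - 1\<close> symbols ahead of the point at which the old one takes its
  decisions. A nonterminal \<open>B\<close> is replaced by triples \<open>(x, B, q)\<close>, where \<open>x\<close> is the buffer of symbols
  already read and \<open>q\<close> consists of the first \<open>k\<close> symbols to the right of the string to be defined by
  \<open>B\<close>. In a linear grammar these are known from the path to the root. Since \<open>q\<close> is made part of the
  string to be defined, reading ahead never leaves the segment of a subtree unless the input ends.
  While the buffer is not full, the next symbol is appended to it; once it has \<open>k - 1\<close> symbols, it
  forms together with the next symbol the argument of the LL(\<open>k\<close>) table, and the rule found there is
  applied, at once also in those conjuncts that begin with a nonterminal.\<close>

section \<open>Words and subtrees\<close>

text \<open>If \<open>x\<close> ends inside \<open>a\<close>, the suffix \<open>b\<close> lies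
  entirely in \<open>z\<close>. This is how the cut-off part of a right context is later removed
  from the unread input.\<close>

lemma append_split_suffix:
  assumes "a @ b = x @ z" "length x \<le> length a \<or> b = []"
  shows "\<exists>z'. z = z' @ b \<and> x @ z' = a"
  using assms by (auto simp: append_eq_append_conv2)

lemma language_of_stringI:
  "String_Rule A w \<in> rules G \<Longrightarrow> w \<in> language_of G A"
  unfolding language_of_def by (auto intro: parse_tree.string_rule)

lemma language_of_conjI:
  assumes "Conj_Rule A cs \<in> rules G"
    and "\<And>u B v. (u, B, v) \<in> set cs \<Longrightarrow> \<exists>y. w = u @ y @ v \<and> y \<in> language_of G B"
  shows "w \<in> language_of G A"
proof -
  \<comment> \<open>Only the tree has to be chosen for each conjunct; \<open>y\<close> is determined
    by \<open>w\<close>, \<open>u\<close> and \<open>v\<close>.\<close>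
  have "\<exists>s. \<forall>u B v. cs ! i = (u, B, v) \<longrightarrow> (\<exists>y. w = u @ y @ v \<and> parse_tree G B y s)"
    if "i < length cs" for i
    using assms(2) nth_mem[OF that] unfolding language_of_def
    by (cases "cs ! i") fastforce
  then obtain f where f: "\<And>i u B v. i < length cs \<Longrightarrow> cs ! i = (u, B, v) \<Longrightarrow>
      \<exists>y. w = u @ y @ v \<and> parse_tree G B y (f i)"
    by metis
  have "parse_tree G A w (Node (Conj_Rule A cs) (map f [0..<length cs]))"
    by (rule parse_tree.conj_rule[OF assms(1)]) (auto dest: f)
  then show ?thesis unfolding language_of_def by blast
qed

text \<open>Tree induction with the trees hidden, for facts that do not depend on the position of a
  subtree.\<close>

lemma language_of_induct [consumes 1, case_names string conj]:
  assumes "w \<in> language_of G A"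
    and string: "\<And>A w. String_Rule A w \<in> rules G \<Longrightarrow> P A w"
    and conj: "\<And>A cs w. Conj_Rule A cs \<in> rules G \<Longrightarrow>
      (\<And>u B v. (u, B, v) \<in> set cs \<Longrightarrow> \<exists>y. w = u @ y @ v \<and> P B y) \<Longrightarrow> P A w"
  shows "P A w"
proof -
  obtain t where "parse_tree G A w t" using assms(1) unfolding language_of_def by blast
  then show ?thesis
  proof induction
    case (string_rule A w)
    then show ?case by (rule string)
  next
    case (conj_rule A cs ts w)
    show ?case
    proof (rule conj[OF conj_rule(1)])
      fix u B v assume "(u, B, v) \<in> set cs"
      then obtain i where "i < length cs" "cs ! i = (u, B, v)" by (metis in_set_conv_nth)
      then show "\<exists>y. w = u @ y @ v \<and> P B y" using conj_rule(3) by blast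
    qed
  qed
qed

lemma parse_tree_root:
  assumes "parse_tree G A w t"
  shows "label t = A" "root_rule t \<in> rules G"
  using assms by (cases; simp add: label_def)+

lemma occupies_parse_tree:
  assumes "parse_tree G A w t" "occupies t w \<tau> p y q"
  shows "w = p @ y @ q \<and> parse_tree G (label \<tau>) y \<tau>"
  using assms(2)
proof induction
  case root
  then show ?case using assms(1) parse_tree_root(1) by fastforce
next
  case (child A cs ts p y q i u B v y')
  then have "parse_tree G (label (Node (Conj_Rule A cs) ts)) y (Node (Conj_Rule A cs) ts)"
    by simp
  then have "\<exists>y''. y = u @ y'' @ v \<and> parse_tree G B y'' (ts ! i)"
    by cases (use child in blast)
  with child show ?case using parse_tree_root(1) by fastforce
qed

lemma occupies_child:
  assumes t: "parse_tree G S w t" and occ: "occupies t w (Node (Conj_Rule A cs) ts) p y q"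
    and "(u, B, v) \<in> set cs"
  obtains \<tau> y' where "\<tau> \<in> set ts" "y = u @ y' @ v" "occupies t w \<tau> (p @ u) y' (v @ q)"
    "label \<tau> = B" "parse_tree G B y' \<tau>"
proof -
  obtain i where i: "i < length cs" "cs ! i = (u, B, v)" using assms(3) by (metis in_set_conv_nth)
  have "parse_tree G (label (Node (Conj_Rule A cs) ts)) y (Node (Conj_Rule A cs) ts)"
    using occupies_parse_tree[OF t occ] by simp
  then obtain y' where "length ts = length cs" "y = u @ y' @ v" "parse_tree G B y' (ts ! i)"
    by cases (use i in blast)
  then show thesis
    using that[of "ts ! i" y'] occupies.child[OF occ] i parse_tree_root(1) by (metis nth_mem)
qed

lemma parse_tree_over_terminals:
  assumes G: "linear_conjunctive_grammar G" and "parse_tree G A w t"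
  shows "w \<in> lists (terminals G)"
proof -
  have "w \<in> language_of G A" using assms(2) unfolding language_of_def by blast
  then show ?thesis
  proof (induction rule: language_of_induct)
    case (string A w)
    then have "wf_rule (terminals G) (nonterminals G) (String_Rule A w)"
      using G unfolding linear_conjunctive_grammar_def by blast
    then show ?case by simp
  next
    case (conj A cs w)
    then have wf: "wf_rule (terminals G) (nonterminals G) (Conj_Rule A cs)"
      using G unfolding linear_conjunctive_grammar_def by blast
    \<comment> \<open>A rule has at least one conjunct, and a single conjunct already spells out all
      of \<open>w\<close>.\<close>
    then obtain u B v where "(u, B, v) \<in> set cs" by (cases cs) auto
    with wf conj(2) show ?case by fastforce
  qed
qed

lemma lhs_in_nonterminals: "wf_rule \<Sigma> N r \<Longrightarrow> lhs r \<in> N"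
  by (cases r) auto

text \<open>A table exists iff the relation from label and lookahead to root rule is functional.
  This allows the LL property to be proved without building a table.\<close>

lemma LL_iff_determined:
  assumes G: "linear_conjunctive_grammar G"
  shows "LL k G \<longleftrightarrow> (\<forall>w t \<tau> p y q w' t' \<tau>' p' y' q'.
     parse_tree G (start G) w t \<longrightarrow> occupies t w \<tau> p y q \<longrightarrow>
     parse_tree G (start G) w' t' \<longrightarrow> occupies t' w' \<tau>' p' y' q' \<longrightarrow>
     label \<tau> = label \<tau>' \<longrightarrow> take k (y @ q) = take k (y' @ q') \<longrightarrow> root_rule \<tau> = root_rule \<tau>')"
    (is "_ \<longleftrightarrow> ?det")
proof
  assume "LL k G"
  then obtain T where "\<And>w t \<tau> p y q. parse_tree G (start G) w t \<Longrightarrow> occupies t w \<tau> p y q \<Longrightarrow>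
      T (label \<tau>, take k (y @ q)) = Some (root_rule \<tau>)"
    unfolding LL_def LL_table_def by blast
  then show ?det by (metis option.inject)
next
  assume det: ?det
  \<comment> \<open>\<open>node\<close> is the graph of the least table: exactly the entries met in
    trees of the start symbol.\<close>
  define node where "node A x r \<longleftrightarrow> (\<exists>w t \<tau> p y q. parse_tree G (start G) w t \<and>
    occupies t w \<tau> p y q \<and> A = label \<tau> \<and> x = take k (y @ q) \<and> r = root_rule \<tau>)" for A x r
  have node_unique: "node A x r \<Longrightarrow> node A x r' \<Longrightarrow> r = r'" for A x r r'
    unfolding node_def using det by metis
  have node_in: "A \<in> nonterminals G \<and> x \<in> lists (terminals G) \<and> length x \<le> k \<and> r \<in> rules G"
    if "node A x r" for A x r
  proof -
    obtain w t \<tau> p y q where n: "parse_tree G (start G) w t" "occupies t w \<tau> p y q"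
      "A = label \<tau>" "x = take k (y @ q)" "r = root_rule \<tau>"
      using \<open>node A x r\<close> unfolding node_def by blast
    have w: "w = p @ y @ q" and r: "r \<in> rules G"
      using occupies_parse_tree[OF n(1,2)] parse_tree_root(2) n(5) by auto
    have "x \<in> lists (terminals G)"
      using parse_tree_over_terminals[OF G n(1)] n(4) w by (auto dest!: in_set_takeD)
    moreover have "A \<in> nonterminals G"
      using r G lhs_in_nonterminals n(3,5) unfolding linear_conjunctive_grammar_def label_def
      by fastforce
    ultimately show ?thesis using r n(4) by simp
  qed
  define T where "T = (\<lambda>(A, x). if \<exists>r. node A x r then Some (THE r. node A x r) else None)"
  have T: "T (A, x) = Some r \<longleftrightarrow> node A x r" for A x r
  proof
    assume "T (A, x) = Some r"
    then obtain r' where "node A x r'" "r = (THE r. node A x r)"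
      unfolding T_def by (auto split: if_splits)
    then show "node A x r" using node_unique by (metis theI)
  next
    assume "node A x r"
    moreover from this have "(THE r. node A x r) = r" using node_unique by blast
    ultimately show "T (A, x) = Some r" unfolding T_def by auto
  qed
  have "LL_table k G T"
    unfolding LL_table_def
  proof (intro conjI allI impI)
    show "dom T \<subseteq> nonterminals G \<times> {x \<in> lists (terminals G). length x \<le> k}"
      using T node_in by fastforce
    show "ran T \<subseteq> rules G" using T node_in unfolding ran_def by fastforce
    show "T (label \<tau>, take k (y @ q)) = Some (root_rule \<tau>)"
      if "parse_tree G (start G) w t" "occupies t w \<tau> p y q" for w t \<tau> p y q
      using that unfolding T node_def by blast
  qed
  then show "LL k G" unfolding LL_def by blast
qed

section \<open>Renaming nonterminals\<close>

text \<open>The constructed grammar has states as nonterminals; this transports it to natural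
  numbers.\<close>

definition rename :: "('n \<Rightarrow> 'm) \<Rightarrow> ('a, 'n) grammar \<Rightarrow> ('a, 'm) grammar" where
  "rename f G = \<lparr>terminals = terminals G, nonterminals = f ` nonterminals G,
     rules = map_rule id f ` rules G, start = f (start G)\<rparr>"

lemma lhs_map_rule: "lhs (map_rule id f r) = f (lhs r)"
  by (cases r) auto

text \<open>Only an inclusion of rule sets is assumed, so the lemma serves both a renaming and its
  inverse.\<close>

lemma parse_tree_map:
  assumes "parse_tree G A w t" "map_rule id f ` rules G \<subseteq> rules H"
  shows "parse_tree H (f A) w (map_ptree id f t)"
  using assms(1)
proof induction
  case (string_rule A w)
  then have "map_rule id f (String_Rule A w) \<in> rules H" using assms(2) by blast
  then show ?case by (simp add: parse_tree.string_rule)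
next
  case (conj_rule A cs ts w)
  then have "map_rule id f (Conj_Rule A cs) \<in> rules H" using assms(2) by blast
  with conj_rule show ?case
    by (fastforce intro!: parse_tree.conj_rule simp: map_prod_def split: prod.splits)
qed

lemma occupies_map:
  assumes "occupies t w \<tau> p y q"
  shows "occupies (map_ptree id f t) w (map_ptree id f \<tau>) p y q"
  using assms
proof induction
  case root
  show ?case by (rule occupies.root)
next
  case (child A cs ts p y q i u B v y')
  have "occupies (map_ptree id f t) w (map (map_ptree id f) ts ! i) (p @ u) y' (v @ q)"
    by (rule occupies.child[where B = "f B" and A = "f A" and y = y and
          cs = "map (map_prod (map id) (map_prod f (map id))) cs"])
      (use child in \<open>auto simp: id_def\<close>)
  with child show ?case by (simp add: id_def)
qed

lemma root_rule_map_ptree: "root_rule (map_ptree id f t) = map_rule id f (root_rule t)"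
  by (cases t) simp

lemma wf_rule_map:
  "wf_rule \<Sigma> N r \<Longrightarrow> wf_rule \<Sigma> (f ` N) (map_rule id f r)"
  by (cases r) (fastforce simp: map_prod_def)+

lemma aligned_rule_map: "aligned_rule \<Sigma> r \<Longrightarrow> aligned_rule \<Sigma> (map_rule id f r)"
  by (cases r) (fastforce simp: map_prod_def)+

lemma map_rule_inverse:
  assumes "wf_rule \<Sigma> N r" "\<And>A. A \<in> N \<Longrightarrow> g (f A) = A"
  shows "map_rule id g (map_rule id f r) = r"
proof (cases r)
  case (Conj_Rule A cs)
  have "map_prod (map id) (map_prod g (map id)) (map_prod (map id) (map_prod f (map id)) c) = c"
    if "c \<in> set cs" for c
    using that assms Conj_Rule by (cases c) (auto simp: list.map_id0 list.map_id)
  then show ?thesis using Conj_Rule assms by (auto intro!: map_idI)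
qed (use assms in auto)

lemma rename_lcg:
  "linear_conjunctive_grammar G \<Longrightarrow> linear_conjunctive_grammar (rename f G)"
  unfolding linear_conjunctive_grammar_def rename_def using wf_rule_map by fastforce

lemma rename_aligned: "aligned G \<Longrightarrow> aligned (rename f G)"
  unfolding aligned_def using rename_lcg aligned_rule_map by (fastforce simp: rename_def)

context
  fixes G :: "('a, 'n) grammar" and f :: "'n \<Rightarrow> 'm" and g :: "'m \<Rightarrow> 'n"
  assumes G: "linear_conjunctive_grammar G"
    and g: "\<And>A. A \<in> nonterminals G \<Longrightarrow> g (f A) = A"
begin

lemma rename_back: "r \<in> rules G \<Longrightarrow> map_rule id g (map_rule id f r) = r"
  using G g map_rule_inverse unfolding linear_conjunctive_grammar_def by metis

lemma parse_tree_rename_back: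
  assumes "parse_tree (rename f G) A w t"
  shows "parse_tree G (g A) w (map_ptree id g t)"
  using assms by (rule parse_tree_map) (auto simp: rename_def rename_back)

lemma start_rename_back: "g (start (rename f G)) = start G"
  using G g unfolding rename_def linear_conjunctive_grammar_def by simp

lemma rename_language: "language (rename f G) = language G"
proof -
  have "parse_tree (rename f G) (f A) w (map_ptree id f t)" if "parse_tree G A w t" for A w t
    using that by (rule parse_tree_map) (simp add: rename_def)
  then have "language G \<subseteq> language (rename f G)"
    unfolding language_def language_of_def by (fastforce simp: rename_def)
  moreover have "language (rename f G) \<subseteq> language G"
    unfolding language_def language_of_def using parse_tree_rename_back start_rename_back by fastforce
  ultimately show ?thesis by blast
qed

text \<open>Trees are carried back to \<open>G\<close>, where the root rules agree; as
  \<open>g\<close> undoes \<open>f\<close> on the rules of \<open>G\<close>, the renamed rules agree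
  too.\<close>

lemma rename_LL:
  assumes "LL k G"
  shows "LL k (rename f G)"
  unfolding LL_iff_determined[OF rename_lcg[OF G]]
proof (intro allI impI)
  let ?H = "rename f G"
  fix w t \<tau> p y q w' t' \<tau>' p' y' q'
  assume t: "parse_tree ?H (start ?H) w t" and \<tau>: "occupies t w \<tau> p y q"
    and t': "parse_tree ?H (start ?H) w' t'" and \<tau>': "occupies t' w' \<tau>' p' y' q'"
    and eq: "label \<tau> = label \<tau>'" "take k (y @ q) = take k (y' @ q')"
  have r: "root_rule \<tau> \<in> rules ?H" "root_rule \<tau>' \<in> rules ?H"
    using occupies_parse_tree[OF t \<tau>] occupies_parse_tree[OF t' \<tau>'] parse_tree_root(2)[of ?H] by auto
  have "label (map_ptree id g \<tau>) = label (map_ptree id g \<tau>')"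
    using eq(1) unfolding label_def root_rule_map_ptree lhs_map_rule by simp
  then have "root_rule (map_ptree id g \<tau>) = root_rule (map_ptree id g \<tau>')"
    using assms eq(2) occupies_map[OF \<tau>] occupies_map[OF \<tau>'] start_rename_back
      parse_tree_rename_back[OF t] parse_tree_rename_back[OF t']
    unfolding LL_iff_determined[OF G] by metis
  then show "root_rule \<tau> = root_rule \<tau>'"
    using r rename_back unfolding root_rule_map_ptree by (auto simp: rename_def)
qed

end

section \<open>The aligned grammar\<close>

text \<open>\<open>Residual x B q\<close> is to define the strings \<open>z\<close> with \<open>x z \<in> L\<^sub>G(B) q\<close>.\<close>

datatype ('a, 'n) state = Residual "'a list" 'n "'a list" | Literal "'a list"

text \<open>The bound on \<open>u\<close> is obtained by enlarging \<open>k\<close>; it makes every \<open>u\<close> a prefix of the lookahead.\<close>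

locale lookahead_table =
  fixes G :: "('a, 'n) grammar" and k :: nat and T :: "'n \<times> 'a list \<rightharpoonup> ('a, 'n) rule"
  assumes lcg: "linear_conjunctive_grammar G"
    and k_pos: "0 < k"
    and prefix_le: "\<And>A cs u B v. Conj_Rule A cs \<in> rules G \<Longrightarrow> (u, B, v) \<in> set cs \<Longrightarrow> length u \<le> k"
    and T_rules: "\<And>A x r. T (A, x) = Some r \<Longrightarrow> r \<in> rules G"
    and T_root: "\<And>w t \<tau> p y q. parse_tree G (start G) w t \<Longrightarrow> occupies t w \<tau> p y q \<Longrightarrow>
      T (label \<tau>, take k (y @ q)) = Some (root_rule \<tau>)"
begin

text \<open>\<open>expand B z q E\<close>: unfolding \<open>B\<close>, seen with lookahead \<open>z\<close> and followed by \<open>q\<close>, through all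
  conjuncts that begin with a nonterminal, and then removing \<open>z\<close>, leaves the conjuncts \<open>E\<close>. Being
  inductive, this has no result where the unfolding would be left-recursive.\<close>

inductive expand :: "'n \<Rightarrow> 'a list \<Rightarrow> 'a list \<Rightarrow> (('a, 'n) state \<times> 'a list) list \<Rightarrow> bool"
  and expand_conjs :: "('a, 'n) conjunct list \<Rightarrow> 'a list \<Rightarrow> 'a list \<Rightarrow>
    (('a, 'n) state \<times> 'a list) list \<Rightarrow> bool"
where
  expand_string: "T (B, z) = Some (String_Rule B y) \<Longrightarrow> y @ q = z @ s \<Longrightarrow>
    expand B z q [(Literal s, [])]"
| expand_conj: "T (B, z) = Some (Conj_Rule B cs) \<Longrightarrow> expand_conjs cs z q E \<Longrightarrow> expand B z q E"
| expand_Nil: "expand_conjs [] z q []"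
| expand_chain: "expand C z (v @ q) E \<Longrightarrow> expand_conjs cs z q E' \<Longrightarrow>
    expand_conjs (([], C, v) # cs) z q (E @ E')"
| expand_step: "u \<noteq> [] \<Longrightarrow> z = u @ x \<Longrightarrow> expand_conjs cs z q E \<Longrightarrow>
    expand_conjs ((u, C, v) # cs) z q ((Residual x C (take k (v @ q)), drop k (v @ q)) # E)"

inductive_cases expandE: "expand B z q E"
inductive_cases expand_conjs_NilE: "expand_conjs [] z q E"
inductive_cases expand_conjs_ConsE: "expand_conjs (c # cs) z q E"

text \<open>The table is a function, and the two cases for a conjunct exclude each other by
  \<open>u = []\<close>. Both finiteness and the LL(1) property rest on this.\<close>

lemma expand_unique:
  shows "expand B z q E \<Longrightarrow> expand B z q E' \<Longrightarrow> E = E'"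
    and "expand_conjs cs z q F \<Longrightarrow> expand_conjs cs z q F' \<Longrightarrow> F = F'"
proof (induction arbitrary: E' and F' rule: expand_expand_conjs.inducts)
  case (expand_string B z y q s)
  from expand_string(3,1,2) show ?case by (auto elim: expandE)
next
  case (expand_conj B z cs q E)
  from expand_conj(4,1,3) show ?case by (auto elim: expandE)
next
  case (expand_Nil z q)
  then show ?case by (auto elim: expand_conjs_NilE)
next
  case (expand_chain C z v q E cs E'')
  from expand_chain(5) obtain E1 E2
    where F': "F' = E1 @ E2" "expand C z (v @ q) E1" "expand_conjs cs z q E2"
    by (rule expand_conjs_ConsE) simp_all
  have "E = E1" "E'' = E2" by (fact expand_chain(2)[OF F'(2)] expand_chain(4)[OF F'(3)])+
  with F'(1) show ?case by simp
next
  case (expand_step u z x cs q E C v)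
  from expand_step(5,1,2,4) show ?case by (auto elim!: expand_conjs_ConsE)
qed

lemma expand_conjs_join:
  assumes "\<And>c. c \<in> set cs \<Longrightarrow> \<exists>E. expand_conjs [c] z q E \<and> (\<forall>e \<in> set E. P e)"
  shows "\<exists>E. expand_conjs cs z q E \<and> (\<forall>e \<in> set E. P e)"
  using assms
proof (induction cs)
  case Nil
  then show ?case using expand_Nil by fastforce
next
  case (Cons c cs)
  obtain E where E: "expand_conjs [c] z q E" "\<forall>e \<in> set E. P e"
    using Cons.prems[of c] by auto
  obtain E' where E': "expand_conjs cs z q E'" "\<forall>e \<in> set E'. P e"
    using Cons.IH Cons.prems by (meson list.set_intros(2))
  have "expand_conjs (c # cs) z q (E @ E')"
    using E(1)
  proof (rule expand_conjs_ConsE)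
    fix C v E1 E2
    assume c: "c = ([], C, v)" "E = E1 @ E2" "expand C z (v @ q) E1" "expand_conjs [] z q E2"
    then have "E2 = []" by (auto elim: expand_conjs_NilE)
    with c show ?thesis using expand_chain[OF c(3) E'(1)] by simp
  next
    \<comment> \<open>\<open>expand_conjs_ConsE\<close> has \<open>take k (v @ q)\<close> and
      \<open>drop k (v @ q)\<close> already distributed over the append.\<close>
    fix u x E2 C v
    assume c: "c = (u, C, v)" "z = u @ x" "u \<noteq> []" "expand_conjs [] (u @ x) q E2"
      "E = (Residual x C (take k v @ take (k - length v) q),
        drop k v @ drop (k - length v) q) # E2"
    then have "E2 = []" by (auto elim: expand_conjs_NilE)
    with c show ?thesis using expand_step[OF c(3,2) E'(1)] by simp
  qed
  then show ?case using E(2) E'(2) by (auto intro!: exI[of _ "E @ E'"])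
qed

section \<open>Rules of the aligned grammar: finiteness and well-formedness\<close>

lemma T_wf: "T (A, x) = Some r \<Longrightarrow> wf_rule (terminals G) (nonterminals G) r"
  using T_rules lcg unfolding linear_conjunctive_grammar_def by blast

text \<open>A conjunctive rule must have a conjunct, and one is needed to see the letter it
  reads.\<close>

lemma expand_nonempty:
  shows "expand B z q E \<Longrightarrow> E \<noteq> []"
    and "expand_conjs cs z q F \<Longrightarrow> cs \<noteq> [] \<longrightarrow> F \<noteq> []"
  by (induction rule: expand_expand_conjs.inducts) (auto dest: T_wf)

text \<open>Literals are left out, as their strings carry no length bound here; they become
  nonterminals only as left-hand sides of rules.\<close>

definition residuals :: "('a, 'n) state set" where
  "residuals = {Residual x B q | x B q. x \<in> lists (terminals G) \<and> length x < k \<and>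
     B \<in> nonterminals G \<and> q \<in> lists (terminals G) \<and> length q \<le> k}"

lemma Residual_in [simp]:
  "Residual x B q \<in> residuals \<longleftrightarrow> x \<in> lists (terminals G) \<and> length x < k \<and>
     B \<in> nonterminals G \<and> q \<in> lists (terminals G) \<and> length q \<le> k"
  "Literal s \<notin> residuals"
  unfolding residuals_def by auto

lemma expand_wf:
  shows "expand B z q E \<Longrightarrow> z \<in> lists (terminals G) \<Longrightarrow> length z = k \<Longrightarrow>
      q \<in> lists (terminals G) \<Longrightarrow> (st, r) \<in> set E \<Longrightarrow>
      r \<in> lists (terminals G) \<and> (st \<in> residuals \<or> (\<exists>s \<in> lists (terminals G). st = Literal s))"
    and "expand_conjs cs z q F \<Longrightarrow> z \<in> lists (terminals G) \<Longrightarrow> length z = k \<Longrightarrow>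
      q \<in> lists (terminals G) \<Longrightarrow> (st, r) \<in> set F \<Longrightarrow>
      (\<forall>(u, B, v) \<in> set cs. u \<in> lists (terminals G) \<and> B \<in> nonterminals G \<and>
        v \<in> lists (terminals G)) \<Longrightarrow>
      r \<in> lists (terminals G) \<and> (st \<in> residuals \<or> (\<exists>s \<in> lists (terminals G). st = Literal s))"
proof (induction rule: expand_expand_conjs.inducts)
  case (expand_string B z y q s)
  have "y \<in> lists (terminals G)" using T_wf[OF expand_string(1)] by simp
  then have "z @ s \<in> lists (terminals G)" using expand_string by (metis append_in_lists_conv)
  then show ?case using expand_string by auto
next
  case (expand_conj B z cs q E)
  then show ?case using T_wf[OF expand_conj(1)] by fastforce
next
  case (expand_chain C z v q E cs E')
  then show ?case by auto
next
  case (expand_step u z x cs q E C v)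
  \<comment> \<open>\<open>u\<close> is nonempty and \<open>z\<close> has exactly \<open>k\<close>
    symbols, so the rest \<open>x\<close> fits into a buffer of fewer than \<open>k\<close>.\<close>
  then have "v @ q \<in> lists (terminals G)" "length x < k" by (auto simp: neq_Nil_conv)
  moreover have "take k (v @ q) \<in> lists (terminals G) \<and> drop k (v @ q) \<in> lists (terminals G)"
    using calculation(1) by (metis append_in_lists_conv append_take_drop_id)
  ultimately show ?case
  proof (cases "(st, r) \<in> set E")
    case True
    then show ?thesis using expand_step by simp
  next
    case False
    then have "st = Residual x C (take k (v @ q))" "r = drop k (v @ q)" using expand_step(8) by auto
    moreover have "x \<in> lists (terminals G)" "C \<in> nonterminals G" using expand_step by auto
    ultimately show ?thesis using \<open>length x < k\<close> \<open>take k (v @ q) \<in> _ \<and> _\<close>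
      by (simp del: take_append drop_append)
  qed
qed auto

lemma finite_residuals: "finite residuals"
proof -
  let ?L = "{x. set x \<subseteq> terminals G \<and> length x \<le> k}"
  have "residuals \<subseteq> (\<lambda>(x, B, q). Residual x B q) ` (?L \<times> nonterminals G \<times> ?L)"
    unfolding residuals_def by (auto simp: image_iff)
  moreover have "finite ?L" "finite (nonterminals G)"
    using lcg finite_lists_length_le unfolding linear_conjunctive_grammar_def by auto
  ultimately show ?thesis by (meson finite_SigmaI finite_imageI finite_subset)
qed

text \<open>\<open>shift\<close> fills the buffer, \<open>unfold\<close> acts once the letter
  completes \<open>k\<close> symbols, and \<open>finish\<close> applies when the buffer already
  holds everything to be defined. \<open>literal\<close> admits only literals left by some
  expansion, which keeps the set finite.\<close>

inductive_set aligned_rules :: "('a, ('a, 'n) state) rule set" where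
  shift: "Residual x B q \<in> residuals \<Longrightarrow> a \<in> terminals G \<Longrightarrow> Suc (length x) < k \<Longrightarrow>
    Conj_Rule (Residual x B q) [([a], Residual (x @ [a]) B q, [])] \<in> aligned_rules"
| unfold: "Residual x B q \<in> residuals \<Longrightarrow> a \<in> terminals G \<Longrightarrow> Suc (length x) = k \<Longrightarrow>
    expand B (x @ [a]) q E \<Longrightarrow>
    Conj_Rule (Residual x B q) (map (\<lambda>(st, v). ([a], st, v)) E) \<in> aligned_rules"
| finish: "Residual (y @ q) B q \<in> residuals \<Longrightarrow> y \<in> language_of G B \<Longrightarrow>
    String_Rule (Residual (y @ q) B q) [] \<in> aligned_rules"
| literal: "Residual x B q \<in> residuals \<Longrightarrow> a \<in> terminals G \<Longrightarrow> Suc (length x) = k \<Longrightarrow>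
    expand B (x @ [a]) q E \<Longrightarrow> (Literal s, v) \<in> set E \<Longrightarrow>
    String_Rule (Literal s) s \<in> aligned_rules"

text \<open>Expansions are unique, so each pair of a residual and a letter contributes finitely many
  rules.\<close>

lemma finite_aligned_rules: "finite aligned_rules"
proof -
  let ?D = "residuals \<times> terminals G"
  define X where "X = (\<lambda>(st, a). case st of Residual x B q \<Rightarrow> {E. expand B (x @ [a]) q E}
    | Literal s \<Rightarrow> {})"
  define sh where "sh = (\<lambda>(st :: ('a, 'n) state, a :: 'a). case st of Residual x B q \<Rightarrow>
     Conj_Rule st [([a], Residual (x @ [a]) B q, [])] | Literal s \<Rightarrow> String_Rule st [])"
  have X1: "finite (X d)" for d
  proof (cases "X d = {}")
    case False
    then obtain E where "E \<in> X d" by blast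
    then have "X d = {E}" unfolding X_def using expand_unique(1)
      by (auto split: prod.splits state.splits)
    then show ?thesis by simp
  qed simp
  have D: "finite ?D" using finite_residuals lcg unfolding linear_conjunctive_grammar_def by simp
  \<comment> \<open>\<open>R\<close> is only a finite upper bound: case branches for the other
    constructor add harmless string rules.\<close>
  define R where "R = sh ` ?D \<union> (\<lambda>st. String_Rule st []) ` residuals \<union>
     (\<Union>d \<in> ?D. \<Union>E \<in> X d. insert (Conj_Rule (fst d) (map (\<lambda>(st, v). ([snd d], st, v)) E))
        ((\<lambda>(st, v). case st of Literal s \<Rightarrow> String_Rule st s
           | Residual x B q \<Rightarrow> String_Rule st []) ` set E))"
  have "finite R" unfolding R_def using D X1 finite_residuals by auto
  moreover have "r \<in> R" if "r \<in> aligned_rules" for r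
    using that
  proof cases
    case (shift x B q a)
    then have "r = sh (Residual x B q, a)" unfolding sh_def by simp
    then show ?thesis using shift unfolding R_def by blast
  next
    case (unfold x B q a E)
    then have "(Residual x B q, a) \<in> ?D" "E \<in> X (Residual x B q, a)" unfolding X_def by auto
    then show ?thesis using unfold(1) unfolding R_def by fastforce
  next
    case (finish y q B)
    then show ?thesis unfolding R_def by blast
  next
    case (literal x B q a E s v)
    then have "(Residual x B q, a) \<in> ?D" "E \<in> X (Residual x B q, a)" unfolding X_def by auto
    moreover have "r \<in> (\<lambda>(st, v). case st of Literal s \<Rightarrow> String_Rule st s
           | Residual x B q \<Rightarrow> String_Rule st []) ` set E"
      using literal by force
    ultimately show ?thesis unfolding R_def by blast
  qed
  ultimately show ?thesis by (meson finite_subset subsetI)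
qed

definition aligned_grammar :: "('a, ('a, 'n) state) grammar" where
  "aligned_grammar = \<lparr>terminals = terminals G, nonterminals = residuals \<union> lhs ` aligned_rules,
     rules = aligned_rules, start = Residual [] (start G) []\<rparr>"

lemma aligned_grammar_simps [simp]:
  "terminals aligned_grammar = terminals G"
  "nonterminals aligned_grammar = residuals \<union> lhs ` aligned_rules"
  "rules aligned_grammar = aligned_rules"
  "start aligned_grammar = Residual [] (start G) []"
  unfolding aligned_grammar_def by simp_all

lemma aligned_rules_wf:
  assumes "r \<in> aligned_rules"
  shows "wf_rule (terminals G) (residuals \<union> lhs ` aligned_rules) r \<and> aligned_rule (terminals G) r"
  using assms
proof cases
  case (shift x B q a)
  then show ?thesis by auto
next
  case (unfold x B q a E)
  have "v \<in> lists (terminals G) \<and> st \<in> residuals \<union> lhs ` aligned_rules" if "(st, v) \<in> set E" for st v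
  proof -
    have "v \<in> lists (terminals G) \<and> (st \<in> residuals \<or> (\<exists>s \<in> lists (terminals G). st = Literal s))"
      using expand_wf(1)[OF unfold(5) _ _ _ that] unfold by simp
    moreover have "Literal s \<in> lhs ` aligned_rules" if "st = Literal s" for s
      using literal[OF unfold(2-5)] \<open>(st, v) \<in> set E\<close> that by (metis imageI lhs.simps(2))
    ultimately show ?thesis by blast
  qed
  then show ?thesis using unfold expand_nonempty(1)[OF unfold(5)] by fastforce
next
  case (finish y q B)
  then show ?thesis by auto
next
  case (literal x B q a E s v)
  have "s \<in> lists (terminals G)"
    using expand_wf(1)[OF literal(5) _ _ _ literal(6)] literal by auto
  moreover have "Literal s \<in> lhs ` aligned_rules" using assms literal(1) by force
  ultimately show ?thesis using literal(1) by simp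
qed

lemma aligned_grammar_lcg: "linear_conjunctive_grammar aligned_grammar"
  using lcg finite_residuals finite_aligned_rules aligned_rules_wf k_pos
  unfolding linear_conjunctive_grammar_def by simp

lemma aligned_grammar_aligned: "aligned aligned_grammar"
  unfolding aligned_def using aligned_grammar_lcg aligned_rules_wf by simp

section \<open>Soundness: the aligned grammar defines no further strings\<close>

text \<open>The intended language of a state. The equation allows the buffer \<open>x\<close> to run
  past \<open>y\<close> into \<open>q\<close>.\<close>

primrec denotes :: "('a, 'n) state \<Rightarrow> 'a list \<Rightarrow> bool" where
  "denotes (Residual x B q) z \<longleftrightarrow> (\<exists>y \<in> language_of G B. x @ z = y @ q)"
| "denotes (Literal s) z \<longleftrightarrow> z = s"

text \<open>Here \<open>z'\<close> is the input after the lookahead. The unfolding is undone rule by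
  rule, each conjunct again covering all of \<open>z @ z'\<close>.\<close>

lemma expand_sound:
  shows "expand B z q E \<Longrightarrow> (\<And>st v. (st, v) \<in> set E \<Longrightarrow> \<exists>z''. z' = z'' @ v \<and> denotes st z'') \<Longrightarrow>
      \<exists>y \<in> language_of G B. z @ z' = y @ q"
    and "expand_conjs cs z q F \<Longrightarrow>
      (\<And>st v. (st, v) \<in> set F \<Longrightarrow> \<exists>z''. z' = z'' @ v \<and> denotes st z'') \<Longrightarrow>
      \<forall>(u, C, v) \<in> set cs. \<exists>y \<in> language_of G C. z @ z' = u @ y @ v @ q"
proof (induction rule: expand_expand_conjs.inducts)
  case (expand_string B z y q s)
  have "z' = s" using expand_string(3)[of "Literal s" "[]"] by simp
  moreover have "y \<in> language_of G B"
    using T_rules[OF expand_string(1)] by (rule language_of_stringI)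
  ultimately show ?case using expand_string(2) by metis
next
  case (expand_conj B z cs q E)
  have all: "\<forall>(u, C, v) \<in> set cs. \<exists>y \<in> language_of G C. z @ z' = u @ y @ v @ q"
    using expand_conj by blast
  \<comment> \<open>One conjunct shows that \<open>z @ z'\<close> ends in \<open>q\<close>;
    cancelling \<open>q\<close> then gives all conjuncts the same \<open>y\<close>.\<close>
  have "cs \<noteq> []" using T_wf[OF expand_conj(1)] by simp
  then obtain u C v where "(u, C, v) \<in> set cs" by (cases cs) auto
  with all obtain y where y: "z @ z' = y @ q" by fastforce
  have "y \<in> language_of G B"
  proof (rule language_of_conjI[OF T_rules[OF expand_conj(1)]])
    fix u C v assume "(u, C, v) \<in> set cs"
    then obtain y' where "y' \<in> language_of G C" "z @ z' = u @ y' @ v @ q" using all by blast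
    then show "\<exists>y'. y = u @ y' @ v \<and> y' \<in> language_of G C" using y by auto
  qed
  with y show ?case by blast
next
  case (expand_chain C z v q E cs E')
  then show ?case by fastforce
next
  case (expand_step u z x cs q E C v)
  obtain z'' y where "z' = z'' @ drop k (v @ q)" "y \<in> language_of G C"
    "x @ z'' = y @ take k (v @ q)"
    using expand_step(5)[of "Residual x C (take k (v @ q))" "drop k (v @ q)"] by auto
  \<comment> \<open>Appending the part cut off by \<open>drop k\<close> restores the full
    context.\<close>
  then have "x @ z' = y @ v @ q" by (metis append.assoc append_take_drop_id)
  with expand_step \<open>y \<in> _\<close> show ?case by auto
qed auto

text \<open>Table entries are rules of \<open>G\<close>, so the unfolding is correct at every state,
  wherever it occurs.\<close>

lemma language_of_aligned_sound:
  assumes "z \<in> language_of aligned_grammar st"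
  shows "denotes st z"
  using assms
proof (induction rule: language_of_induct)
  case (string st z)
  then have "String_Rule st z \<in> aligned_rules" by simp
  then show ?case by cases auto
next
  case (conj st cs z)
  then have "Conj_Rule st cs \<in> aligned_rules" by simp
  then show ?case
  proof cases
    case (shift x B q a)
    then show ?thesis using conj(2) by force
  next
    case (unfold x B q a E)
    \<comment> \<open>One conjunct suffices to see that \<open>z\<close> begins with
      \<open>a\<close>; the others share this letter.\<close>
    obtain st' v where "(st', v) \<in> set E" using expand_nonempty(1)[OF unfold(6)] by (cases E) auto
    then have "([a], st', v) \<in> set cs" using unfold(2) by force
    then obtain z' where z: "z = a # z'" using conj(2) by force
    have "\<exists>z''. z' = z'' @ v \<and> denotes st z''" if "(st, v) \<in> set E" for st v
    proof -
      have "([a], st, v) \<in> set cs" using unfold(2) that by force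
      then show ?thesis using conj(2) z by force
    qed
    then show ?thesis using expand_sound(1)[OF unfold(6), of z'] unfold(1) z by auto
  qed
qed

section \<open>The LL(1) property\<close>

text \<open>Truncation to \<open>k\<close> symbols either yields a full context or cuts off nothing,
  the whole context being short.\<close>

lemma expand_context:
  shows "expand B z c E \<Longrightarrow> (Residual x C q, v) \<in> set E \<Longrightarrow>
      k \<le> length q \<or> v = [] \<and> length c < k"
    and "expand_conjs cs z c F \<Longrightarrow> (Residual x C q, v) \<in> set F \<Longrightarrow>
      k \<le> length q \<or> v = [] \<and> length c < k"
  by (induction rule: expand_expand_conjs.inducts) auto

text \<open>A residual whose right context \<open>q\<close> is shorter than \<open>k\<close> reaches to the end of the input, so the
  empty rule is only applied there.\<close>

lemma residual_context:
  assumes t: "parse_tree aligned_grammar (start aligned_grammar) w t"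
    and occ: "occupies t w \<tau> p z r" and lab: "label \<tau> = Residual x B q"
  shows "k \<le> length q \<or> r = []"
  using occ lab
proof (induction arbitrary: x B q)
  case root
  then show ?case by simp
next
  case (child st cs ts p z r i u st' v z')
  have "parse_tree aligned_grammar st z (Node (Conj_Rule st cs) ts)"
    using occupies_parse_tree[OF t child(1)] by (simp add: label_def)
  then have rule: "Conj_Rule st cs \<in> aligned_rules" by cases auto
  have "parse_tree aligned_grammar (label (ts ! i)) z' (ts ! i)"
    using occupies_parse_tree[OF t occupies.child[OF child(1-5)]] by simp
  moreover have "label (ts ! i) = st'"
  proof -
    have "parse_tree aligned_grammar st z (Node (Conj_Rule st cs) ts)" by fact
    then show ?thesis by cases (use child parse_tree_root(1) in fastforce)
  qed
  ultimately have st': "st' = Residual x B q" using child by simp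
  from rule show ?case
  proof cases
    case (shift x' B' q' a)
    then have "k \<le> length q' \<or> r = []" using child(6)[of x' B' q'] by (simp add: label_def)
    then show ?thesis using child(2,4) shift st' by auto
  next
    case (unfold x' B' q' a E)
    \<comment> \<open>If the child's context is short, so is its parent's, and \<open>v\<close> is
      empty; hence the end of input is inherited.\<close>
    have q': "k \<le> length q' \<or> r = []" using child(6)[of x' B' q'] unfold by (simp add: label_def)
    have "(Residual x B q, v) \<in> set E"
      using child(2,4) unfold(2) st' by (auto simp: case_prod_unfold dest: nth_mem)
    from expand_context(1)[OF unfold(6) this] show ?thesis using q' by auto
  qed
qed

text \<open>This is the LL(1) table in disguise: the end of input selects the empty rule, a letter
  selects a shift or, if it completes \<open>k\<close> symbols, an unfolding.\<close>

lemma root_rule_determined: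
  assumes t: "parse_tree aligned_grammar (start aligned_grammar) w t"
    and occ: "occupies t w \<tau> p z r" and lab: "label \<tau> = Residual x B q"
  shows "(case take 1 (z @ r) of
      [] \<Rightarrow> root_rule \<tau> = String_Rule (Residual x B q) []
    | a # _ \<Rightarrow> (if Suc (length x) < k
         then root_rule \<tau> = Conj_Rule (Residual x B q) [([a], Residual (x @ [a]) B q, [])]
         else \<exists>E. expand B (x @ [a]) q E \<and>
           root_rule \<tau> = Conj_Rule (Residual x B q) (map (\<lambda>(st, v). ([a], st, v)) E)))"
proof -
  have \<tau>: "parse_tree aligned_grammar (Residual x B q) z \<tau>"
    using occupies_parse_tree[OF t occ] lab by simp
  then show ?thesis
  proof cases
    case string_rule
    then have "String_Rule (Residual x B q) z \<in> aligned_rules" by simp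
    then show ?thesis
    proof cases
      case (finish y)
      \<comment> \<open>The buffer \<open>y @ q\<close> has fewer than \<open>k\<close> symbols, so
        \<open>q\<close> is short and the lookahead is empty.\<close>
      then have "r = []" using residual_context[OF t occ lab] by auto
      then show ?thesis using finish string_rule by simp
    qed
  next
    case (conj_rule cs ts)
    have head: "\<exists>z'. z = a # z'" if "([a], st, v) \<in> set cs" for a st v
      using that conj_rule(4) by (fastforce simp: in_set_conv_nth)
    from conj_rule have "Conj_Rule (Residual x B q) cs \<in> aligned_rules" by simp
    then show ?thesis
    proof cases
      case (shift a)
      then show ?thesis using head[of a] conj_rule(1) by auto
    next
      case (unfold a E)
      obtain st' v where "(st', v) \<in> set E" using expand_nonempty(1)[OF unfold(5)] by (cases E) auto
      then have "([a], st', v) \<in> set cs" using unfold(1) by force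
      then show ?thesis using head[of a] conj_rule(1) unfold by fastforce
    qed
  qed
qed

lemma aligned_grammar_LL1: "LL 1 aligned_grammar"
  unfolding LL_iff_determined[OF aligned_grammar_lcg]
proof (intro allI impI)
  let ?H = aligned_grammar
  fix w t \<tau> p y q w' t' \<tau>' p' y' q'
  assume t: "parse_tree ?H (start ?H) w t" and \<tau>: "occupies t w \<tau> p y q"
    and t': "parse_tree ?H (start ?H) w' t'" and \<tau>': "occupies t' w' \<tau>' p' y' q'"
    and eq: "label \<tau> = label \<tau>'" "take 1 (y @ q) = take 1 (y' @ q')"
  show "root_rule \<tau> = root_rule \<tau>'"
  proof (cases "label \<tau>")
    case (Residual x B c)
    \<comment> \<open>The expansion in the last case is unique, so label and letter fix the
      rule.\<close>
    from root_rule_determined[OF t \<tau> this] root_rule_determined[OF t' \<tau>'] this eq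
    show ?thesis by (auto split: list.splits if_splits dest: expand_unique(1))
  next
    case (Literal s)
    have "root_rule \<sigma> = String_Rule (Literal s) s"
      if "root_rule \<sigma> \<in> aligned_rules" "label \<sigma> = Literal s" for \<sigma>
      using that by cases (auto simp: label_def)
    moreover have "root_rule \<tau> \<in> aligned_rules" "root_rule \<tau>' \<in> aligned_rules"
      using occupies_parse_tree[OF t \<tau>] occupies_parse_tree[OF t' \<tau>'] parse_tree_root(2)[of ?H]
      by auto
    ultimately show ?thesis using Literal eq(1) by metis
  qed
qed

section \<open>Completeness: all strings of the original language are defined\<close>

text \<open>The table only describes trees of the start symbol, so completeness is proved for subtrees of a
  fixed tree \<open>t\<close>: \<open>arises w t st z\<close> says that \<open>z\<close> is what \<open>st\<close> has to define at some subtree.\<close>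

primrec arises :: "'a list \<Rightarrow> ('a, 'n) ptree \<Rightarrow> ('a, 'n) state \<Rightarrow> 'a list \<Rightarrow> bool" where
  "arises w t (Residual x B q) z \<longleftrightarrow> Residual x B q \<in> residuals \<and>
     (\<exists>\<tau> p y r. occupies t w \<tau> p y (q @ r) \<and> label \<tau> = B \<and> (k \<le> length q \<or> r = []) \<and>
        x @ z = y @ q)"
| "arises w t (Literal s) z \<longleftrightarrow> z = s"

text \<open>Unfolding follows the leftmost nonterminals down a finite tree, so by induction on the
  subtree it ends; left recursion cannot arise here.\<close>

lemma expand_exists:
  assumes t: "parse_tree G (start G) w t"
    and "occupies t w \<tau> p y (q @ r)" "k \<le> length q \<or> r = []"
    and "y @ q = z @ z'" "length z = k"
  shows "\<exists>E. expand (label \<tau>) z q E \<and>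
    (\<forall>(st, v) \<in> set E. \<exists>z''. z' = z'' @ v \<and> arises w t st z'')"
  using assms(2-4)
proof (induction \<tau> arbitrary: p y q)
  case (Node \<rho> ts)
  have wd: "w = p @ y @ q @ r" and sub: "parse_tree G (label (Node \<rho> ts)) y (Node \<rho> ts)"
    using occupies_parse_tree[OF t Node(2)] by auto
  \<comment> \<open>\<open>y @ q\<close> begins with the \<open>k\<close> symbols of
    \<open>z\<close>, so the lookahead at this node does not reach \<open>r\<close>.\<close>
  have "take k (y @ q @ r) = z"
    using Node(4) assms(5) by (metis append.assoc append_eq_conv_conj)
  then have T: "T (lhs \<rho>, z) = Some \<rho>"
    using T_root[OF t Node(2)] by (simp add: label_def)
  show ?case
  proof (cases \<rho>)
    case (String_Rule B y')
    then have "y' = y" using sub by (auto elim: parse_tree.cases)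
    with String_Rule T Node(4) have "expand B z q [(Literal z', [])]"
      by (auto intro: expand_string)
    then show ?thesis using String_Rule by (auto simp: label_def intro!: exI[of _ "[(Literal z', [])]"])
  next
    case (Conj_Rule B cs)
    have rule: "Conj_Rule B cs \<in> rules G" using T T_rules Conj_Rule by blast
    have "\<exists>E. expand_conjs [c] z q E \<and>
       (\<forall>e \<in> set E. case e of (st, v) \<Rightarrow> \<exists>z''. z' = z'' @ v \<and> arises w t st z'')"
      if c: "c \<in> set cs" for c
    proof -
      obtain u C v where uv: "c = (u, C, v)" by (cases c)
      obtain \<tau> y' where \<tau>: "\<tau> \<in> set ts" "y = u @ y' @ v"
        "occupies t w \<tau> (p @ u) y' (v @ q @ r)" "label \<tau> = C" "parse_tree G C y' \<tau>"
        using occupies_child[OF t] Node(2) c unfolding Conj_Rule uv by metis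
      have occ: "occupies t w \<tau> (p @ u) y' ((v @ q) @ r)" using \<tau>(3) by simp
      show ?thesis
      proof (cases "u = []")
        case True
        \<comment> \<open>The child sees the same \<open>z\<close> and \<open>v\<close> joins its
          context, so the induction hypothesis applies.\<close>
        then obtain E where "expand C z (v @ q) E"
          "\<forall>(st, v) \<in> set E. \<exists>z''. z' = z'' @ v \<and> arises w t st z''"
          using Node(1)[OF \<tau>(1) occ] Node(3,4) \<tau>(2,4) by auto
        then show ?thesis using expand_chain[OF _ expand_Nil] True uv by fastforce
      next
        case False
        \<comment> \<open>The bound on prefixes puts \<open>u\<close> inside the lookahead; what
          remains of \<open>z\<close> is the new buffer \<open>x\<close>.\<close>
        have "length u \<le> length z" using prefix_le rule c uv assms(5) by blast
        moreover have "u @ y' @ v @ q = z @ z'" using Node(4) \<tau>(2) by simp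
        ultimately have "u = take (length u) z" "y' @ v @ q = drop (length u) z @ z'"
          using append_eq_append_conv_if[of u "y' @ v @ q" z z'] by simp_all
        then obtain x where x: "z = u @ x" "y' @ v @ q = x @ z'" by (metis append_take_drop_id)
        let ?q = "take k (v @ q)" and ?v = "drop k (v @ q)"
        have lx: "length x < k" using x(1) False assms(5) by (cases u) auto
        \<comment> \<open>Either \<open>k\<close> symbols of context are kept, or nothing is cut off
          and the context reaches the end of input.\<close>
        have full: "k \<le> length ?q \<or> ?v = [] \<and> r = []" using Node(3) by auto
        have ins: "p @ u @ x @ z' @ r \<in> lists (terminals G)"
          using parse_tree_over_terminals[OF lcg t] wd \<tau>(2) x(2) by (metis append.assoc)
        have "\<exists>z''. z' = z'' @ ?v \<and> x @ z'' = y' @ ?q"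
        proof -
          have "(y' @ ?q) @ ?v = x @ z'" using x(2) by (metis append.assoc append_take_drop_id)
          \<comment> \<open>A kept context of \<open>k\<close> symbols is longer than the buffer, so
            \<open>?v\<close> lies wholly in the unread \<open>z'\<close>.\<close>
          moreover have "length x \<le> length (y' @ ?q) \<or> ?v = []" using full lx by auto
          ultimately show ?thesis using append_split_suffix by metis
        qed
        then obtain z'' where z'': "z' = z'' @ ?v" "x @ z'' = y' @ ?q" by blast
        have "y' @ ?q \<in> lists (terminals G)"
          using ins z'' by (metis append.assoc append_in_lists_conv)
        moreover have "C \<in> nonterminals G"
          using rule c uv lcg unfolding linear_conjunctive_grammar_def by fastforce
        moreover have "occupies t w \<tau> (p @ u) y' (?q @ ?v @ r)"
          using occ by (metis append.assoc append_take_drop_id)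
        ultimately have "arises w t (Residual x C ?q) z''"
          using full lx z''(2) \<tau>(4) ins unfolding arises.simps Residual_in
          by (intro conjI exI[of _ \<tau>] exI[of _ "p @ u"] exI[of _ y'] exI[of _ "?v @ r"]) auto
        then show ?thesis
          using expand_step[OF False x(1) expand_Nil, where q = q and C = C and v = v] uv z''(1)
          by (intro exI[of _ "[(Residual x C ?q, ?v)]"]) auto
      qed
    qed
    then obtain E where E: "expand_conjs cs z q E"
      "\<forall>e \<in> set E. case e of (st, v) \<Rightarrow> \<exists>z''. z' = z'' @ v \<and> arises w t st z''"
      using expand_conjs_join by blast
    have "expand B z q E" using expand_conj[OF _ E(1)] T Conj_Rule by simp
    then show ?thesis using E(2) Conj_Rule by (intro exI[of _ E]) (simp add: label_def)
  qed
qed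

text \<open>Every conjunctive rule of the new grammar reads a letter, so induction on the length of
  the unread string works even when the node \<open>\<tau>\<close> stays the same.\<close>

lemma language_of_aligned_complete:
  assumes t: "parse_tree G (start G) w t"
    and "arises w t (Residual x B q) z"
  shows "z \<in> language_of aligned_grammar (Residual x B q)"
  using assms(2)
proof (induction "length z" arbitrary: x B q z rule: less_induct)
  case less
  obtain \<tau> p y r where n: "occupies t w \<tau> p y (q @ r)" "label \<tau> = B" "k \<le> length q \<or> r = []"
    "x @ z = y @ q" and res: "Residual x B q \<in> residuals"
    using less(2) by auto
  have sub: "w = p @ y @ q @ r" "parse_tree G B y \<tau>" using occupies_parse_tree[OF t n(1)] n(2) by auto
  show ?case
  proof (cases z)
    case Nil
    have "y \<in> language_of G B" using sub(2) unfolding language_of_def by blast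
    then show ?thesis using finish[of y q B] Nil n(4) res by (auto intro!: language_of_stringI)
  next
    case (Cons a z')
    have "y @ q \<in> lists (terminals G)"
      using parse_tree_over_terminals[OF lcg t] sub(1) by simp
    then have a: "a \<in> terminals G" using n(4) Cons by (metis append_in_lists_conv Cons_in_lists_iff)
    show ?thesis
    proof (cases "Suc (length x) < k")
      case True
      have "arises w t (Residual (x @ [a]) B q) z'"
        using n res True a Cons by auto
      then have "z' \<in> language_of aligned_grammar (Residual (x @ [a]) B q)"
        using less(1) Cons by simp
      then show ?thesis
        using language_of_conjI[of _ _ aligned_grammar] shift[OF res a True] Cons by fastforce
    next
      case False
      then have lx: "Suc (length x) = k" using res by simp
      have eq: "y @ q = (x @ [a]) @ z'" using n(4) Cons by simp
      obtain E where E: "expand B (x @ [a]) q E"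
        "\<forall>(st, v) \<in> set E. \<exists>z''. z' = z'' @ v \<and> arises w t st z''"
        using expand_exists[OF t n(1,3) eq] lx n(2) by auto
      have "\<exists>z''. z' = z'' @ v \<and> z'' \<in> language_of aligned_grammar st" if e: "(st, v) \<in> set E" for st v
      proof -
        obtain z'' where z'': "z' = z'' @ v" "arises w t st z''" using E(2) e by blast
        have "z'' \<in> language_of aligned_grammar st"
        proof (cases st)
          case (Residual x' B' q')
          \<comment> \<open>\<open>z''\<close> is a prefix of \<open>z'\<close>, hence shorter than
            \<open>z\<close>.\<close>
          then show ?thesis using less(1)[of z''] z'' Cons by simp
        next
          case (Literal s)
          then show ?thesis
            using literal[OF res a lx E(1)] e z''(2) by (auto intro: language_of_stringI)
        qed
        with z'' show ?thesis by blast
      qed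
      then show ?thesis
        using Cons unfold[OF res a lx E(1)] by (fastforce intro!: language_of_conjI)
    qed
  qed
qed

lemma language_aligned_grammar: "language aligned_grammar = language G"
proof
  show "language aligned_grammar \<subseteq> language G"
    unfolding language_def using language_of_aligned_sound by fastforce
  show "language G \<subseteq> language aligned_grammar"
  proof
    fix w assume "w \<in> language G"
    then obtain t where t: "parse_tree G (start G) w t"
      unfolding language_def language_of_def by blast
    have "label t = start G" using t by (rule parse_tree_root(1))
    \<comment> \<open>The start state is the root of \<open>t\<close> with empty buffer, empty
      context and nothing to its right.\<close>
    then have "arises w t (Residual [] (start G) []) w"
      using occupies.root[of t w] k_pos lcg unfolding linear_conjunctive_grammar_def by auto
    then show "w \<in> language aligned_grammar"
      unfolding language_def using language_of_aligned_complete[OF t] by (simp del: arises.simps)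
  qed
qed

end

section \<open>Choice of the lookahead length and conclusion\<close>

lemma conjunct_prefix_bound:
  assumes "linear_conjunctive_grammar G"
  obtains m where "\<And>A cs u B v. Conj_Rule A cs \<in> rules G \<Longrightarrow> (u, B, v) \<in> set cs \<Longrightarrow> length u \<le> m"
proof -
  let ?U = "\<Union>r \<in> rules G. case r of Conj_Rule A cs \<Rightarrow> (\<lambda>(u, B, v). length u) ` set cs
    | String_Rule A y \<Rightarrow> {}"
  have "finite ?U"
    using assms unfolding linear_conjunctive_grammar_def by (auto split: rule.splits)
  moreover have "length u \<in> ?U" if "Conj_Rule A cs \<in> rules G" "(u, B, v) \<in> set cs" for A cs u B v
    using that by (force intro!: bexI[of _ "Conj_Rule A cs"])
  ultimately show thesis using that[of "Max ?U"] Max_ge by blast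
qed

theorem theorem1:
  fixes G :: "('a, 'n) grammar" and k :: nat
  assumes "k \<ge> 1"
    and "linear_conjunctive_grammar G"
    and "LL k G"
  shows "\<exists>G' :: ('a, nat) grammar.
           linear_conjunctive_grammar G' \<and> aligned G' \<and> LL 1 G' \<and>
           terminals G' = terminals G \<and> language G' = language G"
proof -
  obtain T where T: "LL_table k G T" using assms(3) unfolding LL_def by blast
  obtain m where m: "\<And>A cs u B v. Conj_Rule A cs \<in> rules G \<Longrightarrow> (u, B, v) \<in> set cs \<Longrightarrow> length u \<le> m"
    using conjunct_prefix_bound[OF assms(2)] by blast
  \<comment> \<open>The lookahead is lengthened to bound all prefixes \<open>u\<close>; the given
    table reads its first \<open>k\<close> symbols.\<close>
  interpret lookahead_table G "max k m" "\<lambda>(A, x). T (A, take k x)"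
  proof
    show "(case (A, x) of (A, x) \<Rightarrow> T (A, take k x)) = Some r \<Longrightarrow> r \<in> rules G" for A x r
      using T unfolding LL_table_def by (auto dest: ranI)
    show "length u \<le> max k m"
      if "Conj_Rule A cs \<in> rules G" "(u, B, v) \<in> set cs" for A cs u B v
      using m[OF that] by simp
    show "(case (label \<tau>, take (max k m) (y @ q)) of (A, x) \<Rightarrow> T (A, take k x)) = Some (root_rule \<tau>)"
      if "parse_tree G (start G) w t" "occupies t w \<tau> p y q" for w t \<tau> p y q
    proof -
      have "take k (take (max k m) (y @ q)) = take k (y @ q)" unfolding take_take by simp
      then show ?thesis using T that unfolding LL_table_def by simp
    qed
  qed (use assms in auto)
  \<comment> \<open>The nonterminals are finite, hence embed in the natural numbers, with
    \<open>inv_into\<close> as the inverse for renaming back.\<close>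
  obtain f :: "('a, 'n) state \<Rightarrow> nat" where "inj_on f (nonterminals aligned_grammar)"
    using aligned_grammar_lcg finite_imp_inj_to_nat_seg
    unfolding linear_conjunctive_grammar_def by metis
  then have inv: "inv_into (nonterminals aligned_grammar) f (f A) = A"
    if "A \<in> nonterminals aligned_grammar" for A
    using that by (rule inv_into_f_f)
  show ?thesis
    using rename_lcg[OF aligned_grammar_lcg] rename_aligned[OF aligned_grammar_aligned]
      rename_LL[of _ "inv_into (nonterminals aligned_grammar) f" f,
        OF aligned_grammar_lcg inv aligned_grammar_LL1]
      rename_language[of _ "inv_into (nonterminals aligned_grammar) f" f, OF aligned_grammar_lcg inv]
      language_aligned_grammar
    by (intro exI[of _ "rename f aligned_grammar"]) (auto simp: rename_def)
qed

end
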